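(* For any $a,b\in[\tfrac12,1]$, the box-constrained quadratic program $\min\{x^\top Q(a,b)x+c(a,b)^\top x: x\in[0,1]^4\}$ is submodular and has optimal value $0$.
   Context: For real $a,b$, $$Q(a,b)=\begin{pmatrix}a^2&-a&0&0\\-a&1&-1&0\\0&-1&1&-b\\0&0&-b&\frac14\end{pmatrix},\qquad c(a,b)=\begin{pmatrix}a\\1\\2b-1\\0\end{pmatrix}.$$ A quadratic program with objective $x^\top Qx+c^\top x$ ($Q$ symmetric) is submodular if $Q_{ij}\le 0$ for all $i\ne j$. *)

theory Defs
  imports "HOL-Analysis.Analysis"
begin

definition Q_mat :: "real \<Rightarrow> real \<Rightarrow> real ^ 4 ^ 4" where
  "Q_mat a b = vector
     [vector [a\<^sup>2, - a,   0,     0],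
      vector [ - a,   1, - 1,     0],
      vector [   0, - 1,   1,   - b],
      vector [   0,   0, - b, 1 / 4]]"

definition c_vec :: "real \<Rightarrow> real \<Rightarrow> real ^ 4" where
  "c_vec a b = vector [a, 1, 2 * b - 1, 0]"

definition quad_obj :: "real ^ 'n ^ 'n \<Rightarrow> real ^ 'n \<Rightarrow> real ^ 'n \<Rightarrow> real" where
  "quad_obj Q c x = x \<bullet> (Q *v x) + c \<bullet> x"

text \<open>Symmetry is part of the definition: the sign condition is imposed only on the
  symmetric matrix that represents the quadratic form.\<close>

definition submodular_qp :: "real ^ 'n ^ 'n \<Rightarrow> bool" where
  "submodular_qp Q \<longleftrightarrow> transpose Q = Q \<and> (\<forall>i j. i \<noteq> j \<longrightarrow> Q $ i $ j \<le> 0)"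

definition unit_box :: "(real ^ 'n) set" where
  "unit_box = {x. \<forall>i. 0 \<le> x $ i \<and> x $ i \<le> 1}"

text \<open>The optimal value of a minimization problem is an attained minimum. It is a relation
  rather than an infimum because \<^term>\<open>Inf\<close> on the reals is unspecified for sets that are
  empty or unbounded below.\<close>

definition has_optimal_value :: "('a \<Rightarrow> real) \<Rightarrow> 'a set \<Rightarrow> real \<Rightarrow> bool" where
  "has_optimal_value f S v \<longleftrightarrow> (\<exists>x\<in>S. f x = v) \<and> (\<forall>x\<in>S. v \<le> f x)"

text \<open>The type \<^typ>\<open>4\<close> is cyclic, so its elements are 1, 2, 3 and 4 = 0; the following entry
  tables confirm that the lists above are read in the intended order.\<close>

lemma vector_4_nth:
  fixes p q r s :: "'a::zero"
  shows "(vector [p, q, r, s] :: 'a ^ 4) $ 1 = p"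
    and "(vector [p, q, r, s] :: 'a ^ 4) $ 2 = q"
    and "(vector [p, q, r, s] :: 'a ^ 4) $ 3 = r"
    and "(vector [p, q, r, s] :: 'a ^ 4) $ 4 = s"
  by (simp_all add: vector_def)

lemma Q_mat_nth:
  "Q_mat a b $ 1 $ 1 = a\<^sup>2"  "Q_mat a b $ 1 $ 2 = - a" "Q_mat a b $ 1 $ 3 = 0"   "Q_mat a b $ 1 $ 4 = 0"
  "Q_mat a b $ 2 $ 1 = - a" "Q_mat a b $ 2 $ 2 = 1"   "Q_mat a b $ 2 $ 3 = - 1" "Q_mat a b $ 2 $ 4 = 0"
  "Q_mat a b $ 3 $ 1 = 0"   "Q_mat a b $ 3 $ 2 = - 1" "Q_mat a b $ 3 $ 3 = 1"   "Q_mat a b $ 3 $ 4 = - b"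
  "Q_mat a b $ 4 $ 1 = 0"   "Q_mat a b $ 4 $ 2 = 0"   "Q_mat a b $ 4 $ 3 = - b" "Q_mat a b $ 4 $ 4 = 1 / 4"
  by (simp_all add: Q_mat_def vector_4_nth)

lemma c_vec_nth:
  "c_vec a b $ 1 = a" "c_vec a b $ 2 = 1" "c_vec a b $ 3 = 2 * b - 1" "c_vec a b $ 4 = 0"
  by (simp_all add: c_vec_def vector_4_nth)

end

theory Submission
  imports Defs
begin

text \<open>
  Submodularity is read off the entries. For the optimal value, write the point as
  \<open>(x, y, z, w)\<close> and put \<open>u = a x\<close>; since \<open>u \<ge> 0\<close>, the objective becomes
  \[ f = (u - y)^2 + u + y - 2yz + z^2 + (2b - 1) z + w^2/4 - 2bzw . \]
  The origin has value \<open>0\<close>, so only \<open>f \<ge> 0\<close> is at stake. As a function of \<open>w\<close>, \<open>f\<close> is a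
  convex parabola with vertex \<open>4bz\<close>, which suggests a case distinction on whether the vertex
  lies in \<open>[0,1]\<close>.

  If \<open>4bz \<le> 1\<close>, then also \<open>z \<le> 1/2\<close>, and completing the square in \<open>w\<close> leaves only nonnegative
  summands. If \<open>4bz \<ge> 1\<close>, then \<open>f\<close> is minimal at \<open>w = 1\<close>, and there the linear term \<open>(2b - 1) z\<close>
  of \<open>c\<close> cancels the dependence on \<open>b\<close>: what is left is \<open>(u - y)^2 + u + y - 2yz + (z - 1/2)^2\<close>,
  treated in \<open>residual_nonneg\<close>.
\<close>

lemma quad_obj_Q_mat_expand:
  "quad_obj (Q_mat a b) (c_vec a b) v =
     (a * v $ 1 - v $ 2)\<^sup>2 + a * v $ 1 + v $ 2 - 2 * v $ 2 * v $ 3 + (v $ 3)\<^sup>2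
     + (2 * b - 1) * v $ 3 + (v $ 4)\<^sup>2 / 4 - 2 * b * v $ 3 * v $ 4"
  by (simp add: quad_obj_def inner_vec_def matrix_vector_mult_def sum_4 Q_mat_nth c_vec_nth
      power2_eq_square algebra_simps)

text \<open>Over \<open>u \<ge> 0\<close>, the part \<open>(u - y)\<^sup>2 + u\<close> is minimal at \<open>u = 0\<close> if \<open>y \<le> 1/2\<close> and at
  \<open>u = y - 1/2\<close> otherwise. The whole expression
  is then at least \<open>(y - z + 1/2)\<^sup>2\<close>, respectively \<open>(1 - z) (2y - z)\<close>.\<close>

lemma residual_nonneg:
  fixes u y z :: real
  assumes "0 \<le> u" "z \<le> 1"
  shows "0 \<le> (u - y)\<^sup>2 + u + y - 2 * y * z + (z - 1/2)\<^sup>2"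
proof (cases "y \<le> 1/2")
  case True
  have "(u - y)\<^sup>2 + u + y - 2 * y * z + (z - 1/2)\<^sup>2 =
      u\<^sup>2 + u * (1 - 2 * y) + (y - z + 1/2)\<^sup>2"
    by (simp add: power2_eq_square field_simps)
  moreover have "0 \<le> u * (1 - 2 * y)"
    using True assms by simp
  ultimately show ?thesis by simp
next
  case False
  have "(u - y)\<^sup>2 + u + y - 2 * y * z + (z - 1/2)\<^sup>2 =
      (u - y + 1/2)\<^sup>2 + (1 - z) * (2 * y - z)"
    by (simp add: power2_eq_square field_simps)
  moreover have "0 \<le> (1 - z) * (2 * y - z)"
    using False assms by simp
  ultimately show ?thesis by simp
qed

lemma objective_nonneg:
  fixes b u y z w :: real
  assumes b: "1/2 \<le> b" and u: "0 \<le> u" and y: "0 \<le> y"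
    and z: "0 \<le> z" "z \<le> 1" and w: "w \<le> 1"
  shows "0 \<le> (u - y)\<^sup>2 + u + y - 2 * y * z + z\<^sup>2 + (2 * b - 1) * z + w\<^sup>2 / 4 - 2 * b * z * w"
    (is "0 \<le> ?f")
proof (cases "4 * (b * z) \<le> 1")
  case True
  have "z \<le> 2 * (b * z)"
    using mult_right_mono[OF b z(1)] by simp
  with True have half: "z \<le> 1/2" by simp
  have "?f = (u - y)\<^sup>2 + u + y * (1 - 2 * z) + (2 * b - 1) * z * (1 - (2 * b + 1) * z)
      + (w / 2 - 2 * b * z)\<^sup>2"
    by (simp add: power2_eq_square field_simps)
  moreover have "0 \<le> y * (1 - 2 * z)"
    using y half by simp
  moreover have "0 \<le> (2 * b - 1) * z * (1 - (2 * b + 1) * z)"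
  proof -
    have "0 \<le> 1 - (2 * b + 1) * z"
      using True half by (simp add: algebra_simps)
    then show ?thesis using b z by simp
  qed
  ultimately show ?thesis
    using u by (simp only: add_nonneg_nonneg zero_le_power2)
next
  case False
  \<comment> \<open>The last product is the excess of \<open>f\<close> over its value at \<open>w = 1\<close>.\<close>
  have "?f = ((u - y)\<^sup>2 + u + y - 2 * y * z + (z - 1/2)\<^sup>2)
      + (1 - w) * (2 * (b * z) - (1 + w) / 4)"
    by (simp add: power2_eq_square field_simps)
  moreover have "0 \<le> (1 - w) * (2 * (b * z) - (1 + w) / 4)"
    using False w by (intro mult_nonneg_nonneg) auto
  ultimately show ?thesis using residual_nonneg[OF u z(2), of y] by simp
qed

lemma submodular_qp_Q_mat:
  assumes "0 \<le> a" "0 \<le> b"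
  shows "submodular_qp (Q_mat a b)"
  using assms
  by (simp add: submodular_qp_def transpose_def vec_eq_iff forall_4 Q_mat_nth)

theorem proposition1:
  fixes a b :: real
  assumes "a \<in> {1/2..1}" and "b \<in> {1/2..1}"
  shows "submodular_qp (Q_mat a b)
    \<and> has_optimal_value (quad_obj (Q_mat a b) (c_vec a b)) unit_box 0"
proof
  show "submodular_qp (Q_mat a b)"
    using assms by (intro submodular_qp_Q_mat) auto
  have "0 \<in> (unit_box :: (real ^ 4) set)" "quad_obj (Q_mat a b) (c_vec a b) 0 = 0"
    by (simp_all add: unit_box_def quad_obj_def)
  moreover have "0 \<le> quad_obj (Q_mat a b) (c_vec a b) v" if "v \<in> unit_box" for v
    unfolding quad_obj_Q_mat_expand
    using assms that by (intro objective_nonneg) (auto simp: unit_box_def)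
  ultimately show "has_optimal_value (quad_obj (Q_mat a b) (c_vec a b)) unit_box 0"
    unfolding has_optimal_value_def by blast
qed

end
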